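(* Let $n,k\geq 1$, let $t_1,\dots,t_n$ be integers with $t_i>1$ for all $i$, and let $p_1,\dots,p_k$ be pairwise distinct primes. Assume that $$\prod_{i = 1}^n\frac{t_i!}{t_i^{t_i}} = \prod_{i = 1}^k\frac{p_i!}{p_i^{p_i}}.$$ Then $k = n$ and, after appropriate rearrangement, $t_i = p_i$ for all $i = 1, \ldots, n$. *)

theory Defs
  imports Complex_Main "HOL-Computational_Algebra.Primes" "HOL-Combinatorics.Permutations"
begin

end

theory Submission
  imports Defs
begin

text \<open>
  Write \<open>f m = m! / m ^ m\<close>, so that \<open>f (a + b) \<le> f a * f b\<close> and \<open>f\<close> decreases. After cancelling
  common factors, the multiset \<open>T\<close> of the numbers \<open>t i\<close> and the set \<open>S\<close> of the primes \<open>p i\<close> are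
  disjoint. Suppose they are not both empty and let \<open>r\<close> be the largest prime that is at most
  \<open>max (T \<union> S)\<close>. At \<open>r\<close> the right-hand side has valuation \<open>1 - r\<close> or \<open>0\<close>, according to whether
  \<open>r \<in> S\<close>. On the left-hand side only multiples of \<open>r\<close> contribute negatively, but each of them
  contributes about \<open>-r\<close> times what the other numbers of the same size contribute. Hence balancing
  the two sides forces \<open>C = (\<Sum>m\<in>#T. m div r)\<close> to exceed \<open>card S\<close>, and then
  \<open>(\<Prod>m\<in>#T. f m) \<le> f r ^ C < f r ^ card S \<le> (\<Prod>q\<in>S. f q)\<close>.
\<close>

definition fact_ratio :: "nat \<Rightarrow> real" where
  "fact_ratio m = fact m / real m ^ m"

text \<open>For prime \<open>q\<close> this is the \<open>q\<close>-adic valuation of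
  \<open>fact_ratio m\<close>; it is an integer because it can be negative, as at
  \<open>m = q\<close>.\<close>

definition fact_ratio_val :: "nat \<Rightarrow> nat \<Rightarrow> int" where
  "fact_ratio_val q m = int (multiplicity q (fact m :: nat)) - int (m * multiplicity q m)"

section \<open>Size of \<open>fact_ratio\<close>\<close>

lemma fact_ratio_pos: "fact_ratio m > 0"
  by (cases "m = 0") (auto simp: fact_ratio_def)

text \<open>A single term of the binomial expansion of \<open>(a + b) ^ (a + b)\<close>, the one
  with \<open>a\<close> factors \<open>a\<close> and \<open>b\<close> factors \<open>b\<close>, is
  at most the whole sum.\<close>

lemma fact_ratio_add_le: "fact_ratio (a + b) \<le> fact_ratio a * fact_ratio b"
proof -
  have "real ((a + b) choose a) * real a ^ a * real b ^ b
      \<le> (\<Sum>k\<le>a + b. real ((a + b) choose k) * real a ^ k * real b ^ (a + b - k))"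
    using member_le_sum[of a "{..a + b}" "\<lambda>k. real ((a + b) choose k) * real a ^ k * real b ^ (a + b - k)"]
    by simp
  also have "\<dots> = real (a + b) ^ (a + b)"
    using binomial_ring[of "real a" "real b" "a + b"] by simp
  finally have *: "real ((a + b) choose a) * real a ^ a * real b ^ b \<le> real (a + b) ^ (a + b)" .
  have ch: "real ((a + b) choose a) = fact (a + b) / (fact a * fact b)"
    using binomial_fact[of a "a + b", where 'a = real] by simp
  have pos: "real m ^ m > 0" for m by (cases "m = 0") auto
  have "fact (a + b) * (real a ^ a * real b ^ b) \<le> real (a + b) ^ (a + b) * (fact a * fact b)"
    using * unfolding ch by (simp add: divide_simps mult_ac)
  thus ?thesis
    using pos[of a] pos[of b] pos[of "a + b"]
    by (simp add: fact_ratio_def divide_le_eq le_divide_eq mult_ac del: of_nat_add)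
qed

lemma fact_ratio_le_1: "fact_ratio m \<le> 1"
proof (induction m)
  case (Suc m)
  have "fact_ratio (m + 1) \<le> fact_ratio m * fact_ratio 1" by (rule fact_ratio_add_le)
  also have "fact_ratio 1 = 1" by (simp add: fact_ratio_def)
  finally show ?case using Suc by simp
qed (simp add: fact_ratio_def)

lemma fact_ratio_antimono: "a \<le> b \<Longrightarrow> fact_ratio b \<le> fact_ratio a"
  using fact_ratio_add_le[of a "b - a"]
    mult_left_le[OF fact_ratio_le_1 less_imp_le[OF fact_ratio_pos], of a "b - a"]
  by simp

lemma fact_ratio_less_1: "m \<ge> 2 \<Longrightarrow> fact_ratio m < 1"
  using fact_ratio_antimono[of 2 m] by (simp add: fact_ratio_def[of 2])

text \<open>Discard the remainder of \<open>m\<close> modulo \<open>r\<close> by monotonicity, then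
  split the rest into \<open>m div r\<close> blocks of size \<open>r\<close>.\<close>

lemma fact_ratio_le_power: "fact_ratio m \<le> fact_ratio r ^ (m div r)"
proof -
  have *: "fact_ratio (a * r) \<le> fact_ratio r ^ a" for a
  proof (induction a)
    case (Suc a)
    have "fact_ratio (r + a * r) \<le> fact_ratio r * fact_ratio (a * r)" by (rule fact_ratio_add_le)
    also have "\<dots> \<le> fact_ratio r * fact_ratio r ^ a"
      using Suc fact_ratio_pos[of r] by simp
    finally show ?case by simp
  qed (simp add: fact_ratio_def)
  have "fact_ratio m \<le> fact_ratio (m div r * r)" by (rule fact_ratio_antimono) simp
  with * show ?thesis by (rule order_trans[rotated])
qed

section \<open>Prime valuations of factorials and of \<open>fact_ratio\<close>\<close>

lemma multiplicity_fact_div: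
  assumes "prime (r :: nat)"
  shows "multiplicity r (fact m :: nat) = m div r + multiplicity r (fact (m div r) :: nat)"
proof (induction m)
  case (Suc m)
  have r: "prime_elem r" "r > 0" using assms by (auto simp: prime_gt_0_nat)
  have step: "multiplicity r (fact (Suc j) :: nat) = multiplicity r (Suc j) + multiplicity r (fact j :: nat)" for j
    unfolding fact_Suc of_nat_id by (rule prime_elem_multiplicity_mult_distrib) (use r in auto)
  show ?case
  \<comment> \<open>Both sides grow only when \<open>r\<close> divides \<open>Suc m\<close>: then
    the quotient rises by one to \<open>b\<close>, and \<open>r * b\<close> has one factor
    \<open>r\<close> more than \<open>b\<close>.\<close>
  proof (cases "r dvd Suc m")
    case True
    then obtain b where b: "Suc m = r * b" by blast
    have "b > 0" using b by (cases b) auto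
    have d: "Suc m div r = Suc (m div r)" using True by (simp add: div_Suc dvd_eq_mod_eq_0)
    have "Suc m div r = b" using b r by simp
    have "multiplicity r (Suc m) = Suc (multiplicity r b)"
      unfolding b using r \<open>b > 0\<close> assms by (simp add: prime_elem_multiplicity_mult_distrib)
    thus ?thesis using Suc step[of m] step[of "m div r"] d \<open>Suc m div r = b\<close> by simp
  next
    case False
    hence "Suc m div r = m div r" by (simp add: div_Suc dvd_eq_mod_eq_0)
    thus ?thesis using Suc step[of m] False by (simp add: not_dvd_imp_multiplicity_0)
  qed
qed simp

lemma multiplicity_fact_le:
  assumes "prime (r :: nat)"
  shows "(r - 1) * multiplicity r (fact m :: nat) \<le> m"
proof (induction m rule: less_induct)
  case (less m)
  show ?case
  proof (cases "m = 0")
    case False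
    have r: "r > 1" using assms by (rule prime_gt_1_nat)
    have "(r - 1) * multiplicity r (fact m :: nat)
        = (r - 1) * (m div r) + (r - 1) * multiplicity r (fact (m div r) :: nat)"
      by (subst multiplicity_fact_div[OF assms]) (simp add: algebra_simps)
    also have "\<dots> \<le> (r - 1) * (m div r) + m div r"
      using less[of "m div r"] False r by simp
    also have "\<dots> = r * (m div r)" using r by (cases r) auto
    also have "\<dots> \<le> m" by simp
    finally show ?thesis .
  qed simp
qed

text \<open>The positive term is Legendre's bound, applied after one step of the recursion so that
  \<open>m\<close> is rounded down to a multiple of \<open>r\<close>. The negative term appears when
  \<open>r\<close> divides \<open>m\<close>, since \<open>m ^ m\<close> then has valuation at least
  \<open>m\<close>. The factor \<open>int r - 1\<close> avoids fractions.\<close>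

lemma fact_ratio_val_le:
  assumes "prime r" "m > 0"
  shows "(int r - 1) * fact_ratio_val r m
           \<le> int r * int (m div r) - int r * (int r - 1) * int (if r dvd m then m div r else 0)"
proof -
  have r: "r > 1" using assms(1) by (rule prime_gt_1_nat)
  have "(r - 1) * multiplicity r (fact m :: nat)
      = (r - 1) * (m div r) + (r - 1) * multiplicity r (fact (m div r) :: nat)"
    by (subst multiplicity_fact_div[OF assms(1)]) (simp add: algebra_simps)
  also have "\<dots> \<le> (r - 1) * (m div r) + m div r"
    using multiplicity_fact_le[OF assms(1)] by simp
  also have "\<dots> = r * (m div r)" using r by (cases r) auto
  finally have "int ((r - 1) * multiplicity r (fact m :: nat)) \<le> int (r * (m div r))"
    unfolding of_nat_le_iff .
  hence *: "(int r - 1) * int (multiplicity r (fact m :: nat)) \<le> int r * int (m div r)"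
    using r by (simp add: of_nat_diff)
  show ?thesis
  proof (cases "r dvd m")
    case False
    thus ?thesis using * by (simp add: fact_ratio_val_def not_dvd_imp_multiplicity_0)
  next
    case True
    have "multiplicity r m \<ge> 1"
      using True assms r by (simp add: multiplicity_gt_zero_iff Suc_le_eq)
    hence "m * 1 \<le> m * multiplicity r m" by (intro mult_left_mono) auto
    hence "int m \<le> int (m * multiplicity r m)" by (simp only: of_nat_le_iff mult_1_right)
    hence "(int r - 1) * int m \<le> (int r - 1) * int (m * multiplicity r m)"
      using r by (intro mult_left_mono) auto
    moreover have "int m = int r * int (m div r)" using True by (metis dvd_mult_div_cancel of_nat_mult)
    ultimately show ?thesis using * True by (simp add: fact_ratio_val_def algebra_simps)
  qed
qed

lemma fact_ratio_val_ge_div: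
  assumes "prime r" "\<not> r dvd m"
  shows "fact_ratio_val r m \<ge> int (m div r)"
  using assms multiplicity_fact_div[OF assms(1), of m]
  by (simp add: fact_ratio_val_def not_dvd_imp_multiplicity_0)

lemma fact_ratio_val_less: "prime r \<Longrightarrow> m < r \<Longrightarrow> m > 0 \<Longrightarrow> fact_ratio_val r m = 0"
  using multiplicity_fact_div[of r m] nat_dvd_not_less[of m r]
  by (simp add: fact_ratio_val_def not_dvd_imp_multiplicity_0)

lemma fact_ratio_val_self: "prime r \<Longrightarrow> fact_ratio_val r r = 1 - int r"
  using multiplicity_fact_div[of r r] prime_gt_0_nat[of r]
  by (simp add: fact_ratio_val_def multiplicity_prime)

lemma prod_mset_fact_ratio:
  "prod_mset (image_mset fact_ratio T)
     = real (prod_mset (image_mset fact T)) / real (prod_mset (image_mset (\<lambda>m. m ^ m) T))"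
  by (induction T) (auto simp: fact_ratio_def)

text \<open>Cross-multiplication turns the real equation into one between natural numbers, whose
  multiplicities can be compared.\<close>

lemma fact_ratio_val_sum_eq:
  assumes q: "prime q" and "0 \<notin># T" "0 \<notin># U"
    and eq: "prod_mset (image_mset fact_ratio T) = prod_mset (image_mset fact_ratio U)"
  shows "(\<Sum>m\<in>#T. fact_ratio_val q m) = (\<Sum>m\<in>#U. fact_ratio_val q m)"
proof -
  let ?F = "\<lambda>T. prod_mset (image_mset (fact :: nat \<Rightarrow> nat) T)"
  let ?G = "\<lambda>T. prod_mset (image_mset (\<lambda>m :: nat. m ^ m) T)"
  have nz: "?F T \<noteq> 0" "?G T \<noteq> 0" for T
    by (auto simp: image_iff)
  have "real (?F T) * real (?G U) = real (?F U) * real (?G T)"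
    using eq nz[of T] nz[of U] unfolding prod_mset_fact_ratio by (simp add: divide_simps)
  hence "?F T * ?G U = ?F U * ?G T" by (metis of_nat_eq_iff of_nat_mult)
  hence "multiplicity q (?F T * ?G U) = multiplicity q (?F U * ?G T)" by simp
  hence *: "multiplicity q (?F T) + multiplicity q (?G U) = multiplicity q (?F U) + multiplicity q (?G T)"
    using q nz by (simp add: prime_elem_multiplicity_mult_distrib)
  have "(\<Sum>m\<in>#T. fact_ratio_val q m) = int (multiplicity q (?F T)) - int (multiplicity q (?G T))"
    if "0 \<notin># T" for T
  proof -
    have "(\<Sum>m\<in>#T. fact_ratio_val q m)
        = int (\<Sum>m\<in>#T. multiplicity q (fact m :: nat)) - int (\<Sum>m\<in>#T. m * multiplicity q m)"
      by (induction T) (auto simp: fact_ratio_val_def)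
    also have "(\<Sum>m\<in>#T. multiplicity q (fact m :: nat)) = multiplicity q (?F T)"
      using q that
      by (subst prime_elem_multiplicity_prod_mset_distrib)
        (auto simp: image_mset.compositionality o_def)
    also have "(\<Sum>m\<in>#T. m * multiplicity q m) = (\<Sum>m\<in>#T. multiplicity q (m ^ m))"
    proof (intro arg_cong[of _ _ sum_mset] image_mset_cong)
      fix m assume "m \<in># T"
      hence "m \<noteq> 0" using that by metis
      thus "m * multiplicity q m = multiplicity q (m ^ m)"
        using q by (simp add: prime_elem_multiplicity_power_distrib)
    qed
    also have "\<dots> = multiplicity q (?G T)"
      using q that
      by (subst prime_elem_multiplicity_prod_mset_distrib)
        (auto simp: image_mset.compositionality o_def)
    finally show ?thesis .
  qed
  with assms * show ?thesis by simp
qed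

section \<open>The case of disjoint sides\<close>

lemma disjoint_fact_ratio_prods_empty:
  assumes T: "\<And>m. m \<in># T \<Longrightarrow> m > 1" and fin: "finite S" and S: "\<And>q. q \<in> S \<Longrightarrow> prime q"
    and disj: "\<And>m. m \<in># T \<Longrightarrow> m \<notin> S"
    and eq: "prod_mset (image_mset fact_ratio T) = (\<Prod>q\<in>S. fact_ratio q)"
  shows "T = {#} \<and> S = {}"
proof (rule ccontr)
  assume "\<not> ?thesis"
  hence ne: "set_mset T \<union> S \<noteq> {}" by auto
  have finTS: "finite (set_mset T \<union> S)" using fin by simp
  define M where "M = Max (set_mset T \<union> S)"
  have M: "M \<in> set_mset T \<union> S" unfolding M_def using finTS ne by (rule Max_in)
  have le_M: "m \<le> M" if "m \<in> set_mset T \<union> S" for m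
    unfolding M_def using finTS that by (rule Max_ge)
  have "M \<ge> 2" using M T[of M] S[of M] by (auto dest: prime_ge_2_nat)
  define R where "R = {q. prime q \<and> q \<le> M}"
  have finR: "finite R" unfolding R_def by (rule finite_subset[of _ "{..M}"]) auto
  have neR: "R \<noteq> {}" using \<open>M \<ge> 2\<close> by (auto simp: R_def intro!: exI[of _ 2])
  define r where "r = Max R"
  have "r \<in> R" unfolding r_def using finR neR by (rule Max_in)
  hence r: "prime r" "r \<le> M" by (auto simp: R_def)
  have r2: "r \<ge> 2" using r(1) by (rule prime_ge_2_nat)
  have S_le: "q \<le> r" if "q \<in> S" for q
    unfolding r_def using finR that S le_M by (intro Max_ge) (auto simp: R_def)
  define e :: int where "e = (if r \<in> S then 1 else 0)"
  have sumT: "(\<Sum>m\<in>#T. fact_ratio_val r m) = - (int r - 1) * e"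
  proof -
    have "(\<Sum>m\<in>#T. fact_ratio_val r m) = (\<Sum>m\<in>#mset_set S. fact_ratio_val r m)"
      using T[of 0] S[of 0] fin eq r(1)
      by (intro fact_ratio_val_sum_eq) (auto simp: prod_unfold_prod_mset)
    also have "\<dots> = (\<Sum>q\<in>S. fact_ratio_val r q)" by (simp add: sum_unfold_sum_mset)
    \<comment> \<open>A prime below \<open>r\<close> contributes nothing, as \<open>r\<close>
      divides neither it nor its factorial.\<close>
    also have "\<dots> = (\<Sum>q\<in>S. if q = r then 1 - int r else 0)"
    proof (rule sum.cong)
      fix q assume "q \<in> S"
      thus "fact_ratio_val r q = (if q = r then 1 - int r else 0)"
        using S_le[of q] S[of q] r(1)
        by (auto simp: fact_ratio_val_self fact_ratio_val_less prime_gt_0_nat)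
    qed simp
    also have "\<dots> = - (int r - 1) * e" using fin by (simp add: e_def)
    finally show ?thesis .
  qed
  \<comment> \<open>Members of \<open>T\<close> are positive, so the value 0 of \<open>b\<close> on
    \<open>T\<close> marks exactly the non-multiples of \<open>r\<close>.\<close>
  define b where "b m = (if r dvd m then m div r else 0)" for m
  define B where "B = (\<Sum>m\<in>#T. b m)"
  define C where "C = (\<Sum>m\<in>#T. m div r)"
  have "(int r - 1) * (\<Sum>m\<in>#T. fact_ratio_val r m) \<le> int r * int C - int r * (int r - 1) * int B"
    unfolding B_def C_def using T
  proof (induction T)
    case (add x T)
    from fact_ratio_val_le[OF r(1), of x] add.prems[of x]
    have "(int r - 1) * fact_ratio_val r x \<le> int r * int (x div r) - int r * (int r - 1) * int (b x)"
      by (simp add: b_def)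
    with add show ?case by (simp add: algebra_simps)
  qed simp
  \<comment> \<open>By \<open>sumT\<close> the left-hand side is \<open>- (r - 1)^2 * e\<close>, so
    the weight \<open>B\<close> of the multiples of \<open>r\<close> is controlled by the total
    weight \<open>C\<close>.\<close>
  hence key: "int r * (int r - 1) * int B \<le> int r * int C + (int r - 1) * (int r - 1) * e"
    unfolding sumT by (simp add: algebra_simps)
  have card_C: "card S < C"
  proof (cases "B = 0")
    case True
    \<comment> \<open>Without multiples of \<open>r\<close> every valuation is at least
      \<open>m div r\<close>, while \<open>sumT\<close> is not positive. This forces
      \<open>e = 0\<close> and \<open>C = 0\<close>, which is absurd because \<open>M\<close> then
      lies in \<open>T\<close> and is at least \<open>r\<close>.\<close>
    have "\<not> r dvd m" if "m \<in># T" for m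
    proof -
      have "b m = 0" using True that by (auto simp: B_def)
      thus ?thesis using T[OF that] r2 by (auto simp: b_def div_eq_0_iff dest: dvd_imp_le split: if_splits)
    qed
    hence "fact_ratio_val r m \<ge> int (m div r)" if "m \<in># T" for m
      using that r(1) by (intro fact_ratio_val_ge_div) auto
    hence "int C \<le> (\<Sum>m\<in>#T. fact_ratio_val r m)"
      unfolding C_def by (induction T) (auto intro: add_mono)
    hence "e = 0" "C = 0" using sumT r2 by (auto simp: e_def split: if_splits)
    have "r \<notin> S" using \<open>e = 0\<close> by (simp add: e_def split: if_splits)
    hence "M \<in># T" using M S_le[of M] r(2) by auto
    hence "M div r = 0" using \<open>C = 0\<close> by (auto simp: C_def)
    thus ?thesis using r by (simp add: div_eq_0_iff)
  next
    case B: False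
    show ?thesis
    proof (cases "r \<in> S")
      case False
      hence "e = 0" by (simp add: e_def)
      hence "int r * ((int r - 1) * int B) \<le> int r * int C" using key by (simp add: mult_ac)
      hence "(int r - 1) * int B \<le> int C" using r2 by simp
      moreover have "(int r - 1) * 1 \<le> (int r - 1) * int B" using B r2 by (intro mult_left_mono) auto
      ultimately have "(int r - 1) * 1 \<le> int C" by (rule order_trans[rotated])
      hence "r - 1 \<le> C" by simp
      moreover have "S \<subseteq> {2..<r}" using S S_le False by (force simp: prime_ge_2_nat order.strict_iff_order)
      hence "card S \<le> r - 2" using card_mono[of "{2..<r}" S] by simp
      ultimately show ?thesis using r2 by linarith
    next
      case True
      hence "e = 1" by (simp add: e_def)
      \<comment> \<open>Disjointness makes any multiple of \<open>r\<close> in \<open>T\<close> a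
        proper one, so \<open>B\<close> is at least 2. This outweighs the extra term
        \<open>(r - 1)^2 < r * (r - 1)\<close> in \<open>key\<close> and leaves
        \<open>C > r - 1\<close>.\<close>
      have "r \<notin># T" using True disj by blast
      obtain m where m: "m \<in># T" "b m \<noteq> 0" using B by (auto simp: B_def)
      hence "r dvd m" by (auto simp: b_def split: if_splits)
      then obtain j where j: "m = r * j" by blast
      have "j \<noteq> 0" using j T[OF m(1)] by (cases j) auto
      moreover have "j \<noteq> 1" using j m(1) \<open>r \<notin># T\<close> by auto
      ultimately have "b m \<ge> 2" using j r2 by (auto simp: b_def)
      moreover have "b m \<le> B"
        using m(1) unfolding B_def by (metis insert_DiffM image_mset_add_mset sum_mset.insert le_add1)
      ultimately have "int r * (int r - 1) * 2 \<le> int r * (int r - 1) * int B"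
        using r2 by (intro mult_left_mono) auto
      hence "int r * (int r - 1) < int r * int C" using key \<open>e = 1\<close> r2
        by (simp add: algebra_simps)
      hence "int r - 1 < int C" using r2 by simp
      moreover have "S \<subseteq> {2..r}" using S S_le by (auto simp: prime_ge_2_nat)
      hence "card S \<le> r - 1" using card_mono[of "{2..r}" S] by simp
      ultimately show ?thesis using r2 by linarith
    qed
  qed
  have "prod_mset (image_mset fact_ratio T) \<le> fact_ratio r ^ C"
    unfolding C_def
  proof (induction T)
    case (add x T)
    have "fact_ratio x * prod_mset (image_mset fact_ratio T)
        \<le> fact_ratio r ^ (x div r) * fact_ratio r ^ (\<Sum>m\<in>#T. m div r)"
      using add fact_ratio_le_power[of x r] less_imp_le[OF fact_ratio_pos]
      by (intro mult_mono) (simp_all add: prod_mset_fact_ratio)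
    thus ?case by (simp add: power_add)
  qed simp
  also have "\<dots> < fact_ratio r ^ card S"
    using card_C fact_ratio_pos fact_ratio_less_1[OF r2] by (intro power_strict_decreasing) auto
  also have "\<dots> = (\<Prod>q\<in>S. fact_ratio r)" by simp
  also have "\<dots> \<le> (\<Prod>q\<in>S. fact_ratio q)"
    using S_le less_imp_le[OF fact_ratio_pos] by (intro prod_mono) (auto intro: fact_ratio_antimono)
  finally show False using eq by simp
qed

section \<open>Cancellation of common factors and the theorem\<close>

lemma fact_ratio_prod_eq_imp_mset_eq:
  assumes T: "\<And>m. m \<in># T \<Longrightarrow> m > 1" and fin: "finite S" and S: "\<And>q. q \<in> S \<Longrightarrow> prime q"
    and eq: "prod_mset (image_mset fact_ratio T) = (\<Prod>q\<in>S. fact_ratio q)"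
  shows "T = mset_set S"
proof -
  \<comment> \<open>Each common prime is cancelled once. Further copies may stay in
    \<open>T'\<close>, but they no longer meet \<open>S - D\<close>.\<close>
  define D where "D = S \<inter> set_mset T"
  have D: "mset_set D \<subseteq># T"
    unfolding D_def using fin by (auto simp: subseteq_mset_def count_mset_set' Suc_le_eq)
  define T' where "T' = T - mset_set D"
  have T': "T = T' + mset_set D" using D by (simp add: T'_def)
  have S': "S = (S - D) \<union> D" by (auto simp: D_def)
  have finD: "finite D" using fin by (simp add: D_def)
  have "prod_mset (image_mset fact_ratio T) = prod_mset (image_mset fact_ratio T') * (\<Prod>q\<in>D. fact_ratio q)"
    by (subst T') (simp add: prod_unfold_prod_mset)
  moreover have "(\<Prod>q\<in>S. fact_ratio q) = (\<Prod>q\<in>S - D. fact_ratio q) * (\<Prod>q\<in>D. fact_ratio q)"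
    using fin finD by (subst S', subst prod.union_disjoint) auto
  moreover have "(\<Prod>q\<in>D. fact_ratio q) > 0" by (intro prod_pos) (simp add: fact_ratio_pos)
  ultimately have "prod_mset (image_mset fact_ratio T') = (\<Prod>q\<in>S - D. fact_ratio q)"
    using eq by simp
  hence "T' = {#} \<and> S - D = {}"
  proof (intro disjoint_fact_ratio_prods_empty)
    fix m assume "m \<in># T'"
    hence "m \<in># T" unfolding T'_def by (rule in_diffD)
    thus "m > 1" "m \<notin> S - D" using T by (auto simp: D_def)
  qed (use fin S in auto)
  hence "T' = {#}" "S = D" by (auto simp: D_def)
  thus ?thesis using T' by simp
qed

theorem theorem4p6:
  fixes n k :: nat and t p :: "nat \<Rightarrow> nat"
  assumes "n \<ge> 1" and "k \<ge> 1"
    and "\<And>i. i \<in> {1..n} \<Longrightarrow> t i > 1"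
    and "\<And>i. i \<in> {1..k} \<Longrightarrow> prime (p i)"
    and "inj_on p {1..k}"
    and "(\<Prod>i=1..n. (fact (t i) :: real) / real (t i) ^ t i)
       = (\<Prod>i=1..k. (fact (p i) :: real) / real (p i) ^ p i)"
  shows "k = n \<and> (\<exists>\<sigma>. \<sigma> permutes {1..n} \<and> (\<forall>i\<in>{1..n}. t (\<sigma> i) = p i))"
proof -
  have eq: "(\<Prod>i=1..n. fact_ratio (t i)) = (\<Prod>i=1..k. fact_ratio (p i))"
    using assms(6) by (simp add: fact_ratio_def)
  \<comment> \<open>Injectivity of \<open>p\<close> lets the right-hand product run over the set of
    primes instead of the indices.\<close>
  have "image_mset t (mset_set {1..n}) = mset_set (p ` {1..k})"
  proof (rule fact_ratio_prod_eq_imp_mset_eq)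
    show "prod_mset (image_mset fact_ratio (image_mset t (mset_set {1..n}))) = prod fact_ratio (p ` {1..k})"
      using eq assms(5) by (simp add: prod.reindex image_mset.compositionality o_def flip: prod_unfold_prod_mset)
  qed (use assms(3,4) in auto)
  also have "\<dots> = image_mset p (mset_set {1..k})"
    using assms(5) by (rule image_mset_mset_set[symmetric])
  finally have mset: "image_mset t (mset_set {1..n}) = image_mset p (mset_set {1..k})" .
  from arg_cong[OF this, of size] have "k = n" by simp
  obtain \<sigma> where "\<sigma> permutes {1..n}" "\<forall>i\<in>{1..n}. p i = t (\<sigma> i)"
    using image_mset_eq_implies_permutes[of "{1..n}" p t] mset \<open>k = n\<close> by auto
  thus ?thesis using \<open>k = n\<close> by auto
qed

end
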